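(* Let $K\ge1$. For $k=1,\dots,K$ let $(X^k_t)_{t\in\mathbb{N}}$ be i.i.d. with common mean $\mathsf{E}[X^k_1]=\mu>0$ and standard deviation $\sigma_k$, the $K$ sequences being independent of each other. Let $S^k_t=X^k_1+\dots+X^k_t$ and $Z^k_t=(X^k_1)^2+\dots+(X^k_t)^2$, with $S^k_0=Z^k_0=0$. For thresholds $\Delta^k,\Gamma^k>0$ let $\tau^k_0=\theta^k_0=0$ and, for $n\in\mathbb{N}$, $$\tau^k_n=\inf\{t\ge\tau^k_{n-1}:S^k_t-S^k_{\tau^k_{n-1}}\ge\Delta^k\},\qquad \theta^k_n=\inf\{t\ge\theta^k_{n-1}:Z^k_t-Z^k_{\theta^k_{n-1}}\ge\Gamma^k\}.$$ Let $N^k_t=\max\{n:\tau^k_n\le t\}$, $\tau^k(t)=\tau^k_{N^k_t}$, $M^k_t=\max\{n:\theta^k_n\le t\}$, $\theta^k(t)=\theta^k_{M^k_t}$, $w_k=1/K$, and $$\hat\mu_t=\sum_{k=1}^Kw_k\frac{\Delta^kN^k_t}{\tau^k(t)},\qquad \hat\sigma_t=\sqrt{\sum_{k=1}^Kw_k\frac{\Gamma^kM^k_t}{\theta^k(t)}-(\hat\mu_t)^2}.$$ If $\mathsf{E}[|X^k_1|^3]<\infty$ and $\sigma_k^2=\sigma^2$ for every $1\le k\le K$, then $\hat\sigma_t\to\sigma$ in probability as $\min_k\Gamma^k,\ \min_k\Delta^k,\ t\to\infty$ so that $\max_k\Gamma^k=o(t)$ and $\max_k\Delta^k=o(t)$.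
   Context: The laws of the $X^k_1$ are fixed, with common standard deviation $\sigma>0$; only the thresholds and $t$ vary. The weights are $w_k\propto\sigma_k^{-2}$ with $\sum_kw_k=1$, i.e. $w_k=1/K$ here. On events where $\hat\mu_t$ or $\hat\sigma_t$ is undefined (some $\tau^k(t)=0$ or $\theta^k(t)=0$, or a negative quantity under the square root) they may be given any fixed value. *)

theory Defs
  imports "HOL-Probability.Probability"
begin

(* A path x is indexed by the times 1, 2, 3, ...; its value at 0 is never used. *)

definition psum :: "(nat \<Rightarrow> real) \<Rightarrow> nat \<Rightarrow> real" where
  "psum x t = (\<Sum>j = 1..t. x j)"

(* With D > 0, passage s D n is the n-th time at which s has increased by at least D since the
   previous such time. The value is \<infinity> (Inf of the empty set) if there is no such time, and the
   guard makes all later values \<infinity> as well, so the_enat is only applied to finite values. *)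
primrec passage :: "(nat \<Rightarrow> real) \<Rightarrow> real \<Rightarrow> nat \<Rightarrow> enat" where
  "passage s D 0 = 0"
| "passage s D (Suc n) =
     Inf {enat t | t. passage s D n \<le> enat t \<and> s t - s (the_enat (passage s D n)) \<ge> D}"

lemma passage_ge:
  assumes "D > 0"
  shows "enat n \<le> passage s D n"
proof (induction n)
  case 0
  then show ?case by (simp add: zero_enat_def)
next
  case (Suc n)
  show ?case
    unfolding passage.simps
  proof (rule Inf_greatest)
    fix y
    assume "y \<in> {enat t | t. passage s D n \<le> enat t \<and> s t - s (the_enat (passage s D n)) \<ge> D}"
    then obtain t where t: "y = enat t" "passage s D n \<le> enat t"
      "s t - s (the_enat (passage s D n)) \<ge> D" by blast
    then obtain m where m: "passage s D n = enat m"
      by (cases "passage s D n") auto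
    with t assms have "m \<le> t" "m \<noteq> t" by auto
    with m Suc.IH t(1) show "enat (Suc n) \<le> y" by simp
  qed
qed

(* Hence the maximum in num_passages is over a finite set, which contains 0. *)
lemma finite_passage_le:
  assumes "D > 0"
  shows "finite {n. passage s D n \<le> enat t}"
proof (rule finite_subset)
  show "{n. passage s D n \<le> enat t} \<subseteq> {..t}"
    using order_trans[OF passage_ge[OF assms]] by fastforce
qed simp

definition num_passages :: "(nat \<Rightarrow> real) \<Rightarrow> real \<Rightarrow> nat \<Rightarrow> nat" where
  "num_passages s D t = Max {n. passage s D n \<le> enat t}"

definition last_passage :: "(nat \<Rightarrow> real) \<Rightarrow> real \<Rightarrow> nat \<Rightarrow> nat" where
  "last_passage s D t = the_enat (passage s D (num_passages s D t))"

definition tau_last :: "(nat \<Rightarrow> nat \<Rightarrow> real) \<Rightarrow> (nat \<Rightarrow> real) \<Rightarrow> nat \<Rightarrow> nat \<Rightarrow> nat" where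
  "tau_last x \<Delta> t k = last_passage (psum (x k)) (\<Delta> k) t"

definition theta_last :: "(nat \<Rightarrow> nat \<Rightarrow> real) \<Rightarrow> (nat \<Rightarrow> real) \<Rightarrow> nat \<Rightarrow> nat \<Rightarrow> nat" where
  "theta_last x \<Gamma> t k = last_passage (psum (\<lambda>j. (x k j)\<^sup>2)) (\<Gamma> k) t"

definition mu_hat :: "nat \<Rightarrow> (nat \<Rightarrow> nat \<Rightarrow> real) \<Rightarrow> (nat \<Rightarrow> real) \<Rightarrow> nat \<Rightarrow> real" where
  "mu_hat K x \<Delta> t =
     (\<Sum>k = 1..K. 1 / real K *
        (\<Delta> k * real (num_passages (psum (x k)) (\<Delta> k) t) / real (tau_last x \<Delta> t k)))"

definition var_hat ::
    "nat \<Rightarrow> (nat \<Rightarrow> nat \<Rightarrow> real) \<Rightarrow> (nat \<Rightarrow> real) \<Rightarrow> (nat \<Rightarrow> real) \<Rightarrow> nat \<Rightarrow> real" where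
  "var_hat K x \<Delta> \<Gamma> t =
     (\<Sum>k = 1..K. 1 / real K *
        (\<Gamma> k * real (num_passages (psum (\<lambda>j. (x k j)\<^sup>2)) (\<Gamma> k) t) / real (theta_last x \<Gamma> t k)))
     - (mu_hat K x \<Delta> t)\<^sup>2"

(* c is the value given to the estimator where its formula is undefined (a zero denominator
   or a negative radicand). *)
definition sigma_hat ::
    "real \<Rightarrow> nat \<Rightarrow> (nat \<Rightarrow> nat \<Rightarrow> real) \<Rightarrow> (nat \<Rightarrow> real) \<Rightarrow> (nat \<Rightarrow> real) \<Rightarrow> nat \<Rightarrow> real" where
  "sigma_hat c K x \<Delta> \<Gamma> t =
     (if (\<exists>k\<in>{1..K}. tau_last x \<Delta> t k = 0 \<or> theta_last x \<Gamma> t k = 0) \<or> var_hat K x \<Delta> \<Gamma> t < 0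
      then c else sqrt (var_hat K x \<Delta> \<Gamma> t))"

(* Measurability is required because measure M is 0 on non-measurable sets. *)
definition tendsto_in_prob ::
    "'a measure \<Rightarrow> 'i filter \<Rightarrow> ('i \<Rightarrow> 'a \<Rightarrow> real) \<Rightarrow> real \<Rightarrow> bool" where
  "tendsto_in_prob M F Y y \<longleftrightarrow>
     (\<forall>i. Y i \<in> borel_measurable M) \<and>
     (\<forall>\<epsilon>>0. ((\<lambda>i. measure M {\<omega>\<in>space M. \<bar>Y i \<omega> - y\<bar> > \<epsilon>}) \<longlongrightarrow> 0) F)"

end

theory Submission
  imports Defs "HOL-Real_Asymp.Real_Asymp"
begin

text \<open>
  Consider one i.i.d. sequence with mean \<open>\<mu> > 0\<close>, partial sums \<open>S\<close> and threshold \<open>D\<close>. Truncate the steps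
  at a large constant \<open>A\<close>. Hoeffding's inequality with a union bound over all \<open>s \<le> t\<close> for the truncated
  part, and Markov's inequality for the total excess, show that with high probability
  \<open>\<bar>S s - \<mu> s\<bar> \<le> \<epsilon> t\<close> for all \<open>s \<le> t\<close> and the steps beyond \<open>A\<close> contribute at most \<open>\<epsilon> t\<close>. The rest is
  pathwise. Between the last passage \<open>\<tau>\<close> and \<open>t\<close> the sum rises by less than \<open>D = o(t)\<close>, so
  \<open>t - \<tau> = o(t)\<close>. The \<open>N = O(t / D)\<close> overshoots add up to at most \<open>N A + \<epsilon> t\<close>, so \<open>N D\<close> is close to
  \<open>S \<tau>\<close>, and \<open>N D / \<tau>\<close> is close to \<open>\<mu>\<close>. Applied to the sequences and to their squares, this yields
  the means \<open>\<mu>\<close> and \<open>\<sigma>\<^sup>2 + \<mu>\<^sup>2\<close>, hence the claim by continuity.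
\<close>

section \<open>Passage times as infima in \<open>enat\<close>\<close>

lemma passage_Suc_le:
  assumes "passage s D n = enat m" "m \<le> u" "D \<le> s u - s m"
  shows "passage s D (Suc n) \<le> enat u"
  using assms by (auto intro!: Inf_lower)

text \<open>A finite infimum in \<open>enat\<close> comes from a nonempty set and is attained,
  because \<open>enat\<close> is well-ordered. Hence the defining condition holds at
  \<open>u\<close> itself, and the guard \<open>passage s D n \<le> enat u\<close> forces the
  previous passage to be finite.\<close>

lemma passage_Suc_enatE:
  assumes "passage s D (Suc n) = enat u"
  obtains m where "passage s D n = enat m" "m \<le> u" "D \<le> s u - s m"
proof -
  let ?A = "{enat t | t. passage s D n \<le> enat t \<and> s t - s (the_enat (passage s D n)) \<ge> D}"
  have Inf: "Inf ?A = enat u"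
    using assms by simp
  then have "?A \<noteq> {}"
    unfolding Inf_enat_def by (metis enat.distinct(1))
  then have "Inf ?A \<in> ?A"
    by (metis (no_types, lifting) Inf_enat_def LeastI_ex ex_in_conv)
  then have "passage s D n \<le> enat u" "D \<le> s u - s (the_enat (passage s D n))"
    unfolding Inf by auto
  then show ?thesis
    using that by (cases "passage s D n") auto
qed

text \<open>The maximum defining \<open>num_passages\<close> is attained, so \<open>the_enat\<close>
  in \<open>last_passage\<close> is applied to a finite value, and one more passage by time
  \<open>t\<close> would contradict maximality.\<close>

lemma passage_last_passage:
  assumes "D > 0"
  shows "passage s D (num_passages s D t) = enat (last_passage s D t)"
    and "last_passage s D t \<le> t"
    and "\<not> passage s D (Suc (num_passages s D t)) \<le> enat t"
proof -
  let ?N = "{n. passage s D n \<le> enat t}"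
  have fin: "finite ?N"
    by (rule finite_passage_le[OF assms])
  have "0 \<in> ?N"
    by simp
  then have "num_passages s D t \<in> ?N"
    unfolding num_passages_def using fin Max_in by blast
  then obtain m where "passage s D (num_passages s D t) = enat m" "m \<le> t"
    by (cases "passage s D (num_passages s D t)") auto
  then show "passage s D (num_passages s D t) = enat (last_passage s D t)"
    and "last_passage s D t \<le> t"
    by (simp_all add: last_passage_def)
  show "\<not> passage s D (Suc (num_passages s D t)) \<le> enat t"
    using Max_ge[OF fin, of "Suc (num_passages s D t)"] by (auto simp: num_passages_def)
qed

lemma passage_increment_less:
  assumes "D > 0" "last_passage s D t \<le> u" "u \<le> t"
  shows "s u - s (last_passage s D t) < D"
proof (rule ccontr)
  assume "\<not> ?thesis"
  then have "passage s D (Suc (num_passages s D t)) \<le> enat u"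
    using passage_Suc_le[OF passage_last_passage(1)[OF assms(1)]] assms(2) by auto
  then show False
    using passage_last_passage(3)[OF assms(1), of s t] assms(3)
    by (meson enat_ord_simps(1) order_trans)
qed

section \<open>Truncation and pathwise bounds for sums at passage times\<close>

definition trunc :: "real \<Rightarrow> real \<Rightarrow> real" where
  "trunc A x = (if \<bar>x\<bar> \<le> A then x else 0)"

text \<open>Since \<open>trunc\<close> sends large values to 0 instead of clipping them, this is
  \<bar>x\<bar> above the level A and 0 elsewhere.\<close>

definition excess :: "real \<Rightarrow> real \<Rightarrow> real" where
  "excess A x = \<bar>x - trunc A x\<bar>"

lemma excess_nonneg [simp]: "0 \<le> excess A x"
  by (simp add: excess_def)

lemma le_add_excess: "0 \<le> A \<Longrightarrow> x \<le> A + excess A x"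
  by (auto simp: excess_def trunc_def)

lemma measurable_trunc [measurable]: "trunc A \<in> borel_measurable borel"
  unfolding trunc_def by measurable

lemma measurable_excess [measurable]: "excess A \<in> borel_measurable borel"
  unfolding excess_def by measurable

lemma psum_Suc [simp]: "psum x (Suc n) = psum x n + x (Suc n)"
  by (simp add: psum_def)

lemma psum_0 [simp]: "psum x 0 = 0"
  by (simp add: psum_def)

text \<open>Each overshoot of the level \<open>D\<close> is at most the step that caused it.\<close>
lemma passage_psum_bounds:
  assumes "D > 0" "A \<ge> 0" "passage (psum x) D n = enat m"
  shows "real n * D \<le> psum x m"
    and "psum x m \<le> real n * (D + A) + (\<Sum>j = 1..m. excess A (x j))"
proof -
  have "real n * D \<le> psum x m \<and> psum x m \<le> real n * (D + A) + (\<Sum>j = 1..m. excess A (x j))"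
    using assms(3)
  proof (induction n arbitrary: m)
    case 0
    then have "m = 0"
      by (simp add: zero_enat_def)
    then show ?case
      by simp
  next
    case (Suc n u)
    then obtain m where m: "passage (psum x) D n = enat m" "m \<le> u" "D \<le> psum x u - psum x m"
      by (elim passage_Suc_enatE)
    with \<open>D > 0\<close> have "m \<noteq> u"
      by auto
    \<comment> \<open>The time \<open>v\<close> is the last one before the passage at
      \<open>u\<close>. The increment there is still below \<open>D\<close>, so the overshoot at
      \<open>u\<close> is due to the single step \<open>x u\<close>, which is at most
      \<open>A\<close> plus its excess.\<close>
    then obtain v where v: "u = Suc v" "m \<le> v"
      using m(2) by (cases u) auto
    have "psum x v - psum x m < D"
    proof (rule ccontr)
      assume "\<not> ?thesis"
      then have "passage (psum x) D (Suc n) \<le> enat v"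
        using passage_Suc_le[of "psum x" D n m v] m v by auto
      then show False
        using Suc.prems v by simp
    qed
    moreover have "(\<Sum>j = 1..m. excess A (x j)) \<le> (\<Sum>j = 1..v. excess A (x j))"
      using v by (intro sum_mono2) auto
    ultimately show ?case
      using Suc.IH[OF m(1)] m(3) le_add_excess[OF assms(2), of "x u"] v
      by (simp add: algebra_simps)
  qed
  then show "real n * D \<le> psum x m"
    and "psum x m \<le> real n * (D + A) + (\<Sum>j = 1..m. excess A (x j))"
    by auto
qed

text \<open>The deterministic core: if the path stays within \<epsilon> t of its drift up to time t
  and its large steps contribute little, then \<open>N * D\<close> is within 3 \<epsilon> t of \<mu>
  \<tau>. Dividing by \<tau>, which is at least t / 2, doubles the constant to 6.\<close>

lemma passage_rate_bound:
  fixes D A \<mu> \<epsilon> :: real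
  assumes "D > 0" "A > 0" "t > 0" "\<mu> > 0" "0 < \<epsilon>" "6 * \<epsilon> \<le> \<mu>"
    and D_t: "D \<le> \<epsilon> * t" and A_D: "A * (2 * \<mu>) \<le> \<epsilon> * D"
    and dev: "\<And>s. s \<le> t \<Longrightarrow> \<bar>psum x s - \<mu> * s\<bar> \<le> \<epsilon> * t"
    and exc: "(\<Sum>j = 1..t. excess A (x j)) \<le> \<epsilon> * t"
  shows "last_passage (psum x) D t > 0"
    and "\<bar>D * num_passages (psum x) D t / last_passage (psum x) D t - \<mu>\<bar> \<le> 6 * \<epsilon>"
proof -
  define \<tau> where "\<tau> = last_passage (psum x) D t"
  define N where "N = num_passages (psum x) D t"
  have pas: "passage (psum x) D N = enat \<tau>" and "\<tau> \<le> t"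
    unfolding \<tau>_def N_def using passage_last_passage[OF \<open>D > 0\<close>] by auto
  have "psum x t - psum x \<tau> < D"
    unfolding \<tau>_def by (rule passage_increment_less) (use assms \<open>\<tau> \<le> t\<close> in \<open>auto simp: \<tau>_def\<close>)
  \<comment> \<open>The deviations at t and at \<tau> and the threshold \<open>D\<close> cost
    \<epsilon> t each. By \<open>6 * \<epsilon> \<le> \<mu>\<close> the total is at most half of
    \<mu> t, whence t \<le> 2 \<tau>.\<close>
  with dev[of t] dev[of \<tau>] D_t \<open>\<tau> \<le> t\<close> have "\<mu> * t - \<mu> * \<tau> \<le> 3 * (\<epsilon> * t)"
    by (simp add: abs_le_iff)
  moreover have "6 * \<epsilon> * t \<le> \<mu> * t"
    using assms by (intro mult_right_mono) auto
  ultimately have "\<mu> * t \<le> \<mu> * (2 * \<tau>)"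
    by simp
  then have t_\<tau>: "real t \<le> 2 * \<tau>"
    using \<open>\<mu> > 0\<close> by simp
  then have "\<tau> > 0"
    using \<open>t > 0\<close> by auto
  have lower: "N * D \<le> psum x \<tau>"
    using passage_psum_bounds(1)[OF \<open>D > 0\<close> _ pas, of A] \<open>A > 0\<close> by simp
  have "(\<Sum>j = 1..\<tau>. excess A (x j)) \<le> (\<Sum>j = 1..t. excess A (x j))"
    using \<open>\<tau> \<le> t\<close> by (intro sum_mono2) auto
  then have upper: "psum x \<tau> \<le> N * D + N * A + \<epsilon> * t"
    using passage_psum_bounds(2)[OF \<open>D > 0\<close> _ pas, of A] \<open>A > 0\<close> exc
    by (simp add: algebra_simps)
  have "\<mu> * \<tau> \<le> \<mu> * t"
    using \<open>\<tau> \<le> t\<close> \<open>\<mu> > 0\<close> by simp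
  moreover have "\<epsilon> * t \<le> \<mu> * t"
    using assms by (intro mult_right_mono) auto
  \<comment> \<open>This crude bound on \<open>N * D\<close> serves only to turn \<open>A_D\<close>
    into \<open>N * A \<le> \<epsilon> * t\<close>: the steps of size at most \<open>A\<close> add a
    negligible amount of overshoot because \<open>A\<close> is small compared with
    \<open>D\<close>.\<close>
  ultimately have ND: "N * D \<le> 2 * \<mu> * t"
    using lower dev[OF \<open>\<tau> \<le> t\<close>] by (simp add: abs_le_iff)
  have "N * A * (2 * \<mu>) \<le> \<epsilon> * (N * D)"
    using mult_left_mono[OF A_D, of "real N"] by (simp add: algebra_simps)
  also have "\<dots> \<le> \<epsilon> * (2 * \<mu> * t)"
    using ND \<open>\<epsilon> > 0\<close> by simp
  finally have "(2 * \<mu>) * (N * A) \<le> (2 * \<mu>) * (\<epsilon> * t)"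
    by (simp add: algebra_simps)
  then have "N * A \<le> \<epsilon> * t"
    using \<open>\<mu> > 0\<close> by simp
  \<comment> \<open>The three errors are the overshoots \<open>N * A\<close>, the total excess, and
    the deviation of the sum at \<tau>.\<close>
  then have "\<bar>D * N - \<mu> * \<tau>\<bar> \<le> 3 * (\<epsilon> * t)"
    using lower upper dev[OF \<open>\<tau> \<le> t\<close>] unfolding abs_le_iff mult.commute[of D] by linarith
  also have "\<dots> \<le> 3 * (\<epsilon> * (2 * \<tau>))"
    using t_\<tau> \<open>\<epsilon> > 0\<close> by simp
  finally have "\<bar>D * N - \<mu> * \<tau>\<bar> \<le> 6 * \<epsilon> * \<tau>"
    by simp
  moreover have "D * N / \<tau> - \<mu> = (D * N - \<mu> * \<tau>) / \<tau>"
    using \<open>\<tau> > 0\<close> by (simp add: field_simps)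
  ultimately show "\<bar>D * num_passages (psum x) D t / last_passage (psum x) D t - \<mu>\<bar> \<le> 6 * \<epsilon>"
    using \<open>\<tau> > 0\<close> by (simp add: abs_divide divide_le_eq flip: \<tau>_def N_def)
  show "last_passage (psum x) D t > 0"
    using \<open>\<tau> > 0\<close> by (simp add: \<tau>_def)
qed

section \<open>Measurability of passage times and counts\<close>

lemma measurable_passage:
  assumes [measurable]: "\<And>u. (\<lambda>\<omega>. s \<omega> u) \<in> borel_measurable M"
  shows "(\<lambda>\<omega>. passage (s \<omega>) D n) \<in> measurable M (count_space UNIV)"
proof (induction n)
  case 0
  then show ?case by simp
next
  case (Suc n)
  \<comment> \<open>With the starting time frozen at a deterministic \<open>m\<close>, the next
    passage is a \<open>LEAST\<close> over countably many measurable conditions, or \<infinity> if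
    none holds. The random starting time is then handled by a case split over its countably many
    values.\<close>
  define next_p where "next_p m \<omega> = (if \<exists>u. m \<le> u \<and> D \<le> s \<omega> u - s \<omega> m
      then enat (LEAST u. m \<le> u \<and> D \<le> s \<omega> u - s \<omega> m) else \<infinity>)" for m \<omega>
  have next_p [measurable]: "next_p m \<in> measurable M (count_space UNIV)" for m
    unfolding next_p_def by measurable
  have eq: "passage (s \<omega>) D (Suc n) =
      (case passage (s \<omega>) D n of enat m \<Rightarrow> next_p m \<omega> | \<infinity> \<Rightarrow> \<infinity>)" for \<omega>
  proof (cases "passage (s \<omega>) D n")
    case (enat m)
    show ?thesis
    proof (cases "\<exists>u. m \<le> u \<and> D \<le> s \<omega> u - s \<omega> m")
      case True
      let ?L = "LEAST u. m \<le> u \<and> D \<le> s \<omega> u - s \<omega> m"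
      have "m \<le> ?L \<and> D \<le> s \<omega> ?L - s \<omega> m"
        using True by (rule LeastI_ex)
      then have "passage (s \<omega>) D (Suc n) = enat ?L"
        using enat by (auto intro!: antisym[OF Inf_lower Inf_greatest] Least_le)
      then show ?thesis
        using True enat by (simp add: next_p_def)
    next
      case False
      then show ?thesis
        using enat by (auto simp: next_p_def Inf_enat_def)
    qed
  \<comment> \<open>After an infinite value the guard leaves the empty set, whose infimum is again
    \<infinity>.\<close>
  qed (simp add: Inf_enat_def)
  show ?case
    unfolding eq by (rule measurable_case_enat) (use Suc in auto)
qed

lemma measurable_num_passages:
  assumes "\<And>u. (\<lambda>\<omega>. s \<omega> u) \<in> borel_measurable M"
  shows "(\<lambda>\<omega>. num_passages (s \<omega>) D t) \<in> measurable M (count_space UNIV)"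
proof -
  note [measurable] = measurable_passage[of s, OF assms]
  show ?thesis
    unfolding num_passages_def by measurable
qed

lemma measurable_last_passage:
  assumes "\<And>u. (\<lambda>\<omega>. s \<omega> u) \<in> borel_measurable M"
  shows "(\<lambda>\<omega>. last_passage (s \<omega>) D t) \<in> measurable M (count_space UNIV)"
proof -
  have "(\<lambda>\<omega>. passage (s \<omega>) D (num_passages (s \<omega>) D t)) \<in> measurable M (count_space UNIV)"
    by (rule measurable_compose_countable[OF measurable_passage measurable_num_passages]) fact+
  then show ?thesis
    unfolding last_passage_def by (rule measurable_compose) simp
qed

lemma measurable_psum:
  assumes "\<And>j. j \<ge> 1 \<Longrightarrow> X j \<in> borel_measurable M"
  shows "(\<lambda>\<omega>. psum (\<lambda>j. X j \<omega>) u) \<in> borel_measurable M"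
  unfolding psum_def using assms by (intro borel_measurable_sum) auto

text \<open>The excesses are nonnegative, so the total up to n bounds the truncation error at every
  s \<le> n simultaneously. A single Markov estimate then covers all of these times.\<close>

lemma abs_psum_diff_trunc_le:
  assumes "s \<le> n"
  shows "\<bar>psum x s - (\<Sum>j = 1..s. trunc A (x j))\<bar> \<le> (\<Sum>j = 1..n. excess A (x j))"
proof -
  have "\<bar>psum x s - (\<Sum>j = 1..s. trunc A (x j))\<bar> \<le> (\<Sum>j = 1..s. excess A (x j))"
    unfolding psum_def excess_def by (simp add: sum_abs flip: sum_subtractf)
  also have "\<dots> \<le> (\<Sum>j = 1..n. excess A (x j))"
    using assms by (intro sum_mono2) auto
  finally show ?thesis .
qed

section \<open>Probability estimates for one i.i.d. sequence\<close>

context prob_space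
begin

text \<open>Dominated convergence: at each \<omega> the excess vanishes once A reaches \<bar>Y
  \<omega>\<bar>, and \<bar>Y\<bar> dominates it throughout.\<close>

lemma excess_expectation_tendsto_0:
  fixes Y :: "'a \<Rightarrow> real"
  assumes "integrable M Y"
  shows "((\<lambda>A. expectation (\<lambda>\<omega>. excess A (Y \<omega>))) \<longlongrightarrow> 0) at_top"
proof -
  have [measurable]: "Y \<in> borel_measurable M"
    using assms by simp
  have "((\<lambda>A. expectation (\<lambda>\<omega>. excess A (Y \<omega>))) \<longlongrightarrow> expectation (\<lambda>_. 0)) at_top"
  proof (rule integral_dominated_convergence_at_top[where w = "\<lambda>\<omega>. \<bar>Y \<omega>\<bar>"])
    show "AE \<omega> in M. ((\<lambda>A. excess A (Y \<omega>)) \<longlongrightarrow> 0) at_top"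
    proof (rule AE_I2, rule tendsto_eventually)
      fix \<omega>
      show "\<forall>\<^sub>F A in at_top. excess A (Y \<omega>) = 0"
        using eventually_ge_at_top[of "\<bar>Y \<omega>\<bar>"]
        by eventually_elim (simp add: excess_def trunc_def)
    qed
    show "\<forall>\<^sub>F A in at_top. AE \<omega> in M. norm (excess A (Y \<omega>)) \<le> \<bar>Y \<omega>\<bar>"
      by (intro always_eventually allI AE_I2) (simp add: excess_def trunc_def)
  qed (use assms in auto)
  then show ?thesis
    by simp
qed

lemma expectation_eq_of_distr_eq:
  fixes f :: "real \<Rightarrow> real"
  assumes "distr M borel Y = distr M borel Z" "Y \<in> borel_measurable M" "Z \<in> borel_measurable M"
    and "f \<in> borel_measurable borel"
  shows "expectation (\<lambda>\<omega>. f (Y \<omega>)) = expectation (\<lambda>\<omega>. f (Z \<omega>))"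
  using assms by (metis integral_distr)

lemma integrable_of_distr_eq:
  fixes f :: "real \<Rightarrow> real"
  assumes "distr M borel Y = distr M borel Z" "Y \<in> borel_measurable M" "Z \<in> borel_measurable M"
    and "f \<in> borel_measurable borel" "integrable M (\<lambda>\<omega>. f (Z \<omega>))"
  shows "integrable M (\<lambda>\<omega>. f (Y \<omega>))"
  using assms by (metis integrable_distr_eq)

text \<open>Hoeffding's inequality for s variables with values in an interval of length 2 A. The
  deviation is measured against n rather than s, so the bound does not depend on s and is suited to
  a union bound over s \<le> n.\<close>

lemma trunc_sum_deviation_prob_le:
  fixes X :: "nat \<Rightarrow> 'a \<Rightarrow> real" and A r :: real and s n :: nat
  assumes indep: "indep_vars (\<lambda>_. borel) X {1..}"
    and ident: "\<And>j. j \<ge> 1 \<Longrightarrow> distr M borel (X j) = distr M borel (X 1)"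
    and "A > 0" "r \<ge> 0" "1 \<le> s" "s \<le> n"
  shows "prob {\<omega>\<in>space M. \<bar>(\<Sum>j = 1..s. trunc A (X j \<omega>)) -
             s * expectation (\<lambda>\<omega>. trunc A (X 1 \<omega>))\<bar> \<ge> r * n}
         \<le> 2 * exp (- (r\<^sup>2 / (2 * A\<^sup>2)) * n)"
proof -
  have rv: "X j \<in> borel_measurable M" if "j \<ge> 1" for j
    using indep that by (auto simp: indep_vars_def)
  have [measurable]: "X 1 \<in> borel_measurable M"
    by (rule rv) simp
  interpret H: Hoeffding_ineq_iid M "{1..s}" "\<lambda>j \<omega>. trunc A (X j \<omega>)" "\<lambda>\<omega>. trunc A (X 1 \<omega>)" "-A" A
    "expectation (\<lambda>\<omega>. trunc A (X 1 \<omega>))"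
  proof unfold_locales
    show "indep_vars (\<lambda>_. borel) (\<lambda>j \<omega>. trunc A (X j \<omega>)) {1..s}"
      by (rule indep_vars_compose2[OF indep_vars_subset[OF indep]]) auto
    show "distr M borel (\<lambda>\<omega>. trunc A (X j \<omega>)) = distr M borel (\<lambda>\<omega>. trunc A (X 1 \<omega>))"
      if "j \<in> {1..s}" for j
    proof -
      have "distr (distr M borel (X j)) borel (trunc A) = distr (distr M borel (X 1)) borel (trunc A)"
        using ident[of j] that by simp
      moreover have "X j \<in> borel_measurable M"
        using rv that by simp
      ultimately show ?thesis
        by (simp only: distr_distr measurable_trunc \<open>X 1 \<in> borel_measurable M\<close> comp_def)
    qed
    show "AE \<omega> in M. trunc A (X 1 \<omega>) \<in> {-A..A}"
      using \<open>A > 0\<close> by (intro AE_I2) (auto simp: trunc_def)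
    show "(\<lambda>\<omega>. trunc A (X 1 \<omega>)) \<in> borel_measurable M"
      by measurable
  qed (rule finite_atLeastAtMost refl)+
  have "prob {\<omega>\<in>space M. \<bar>(\<Sum>j = 1..s. trunc A (X j \<omega>)) -
             s * expectation (\<lambda>\<omega>. trunc A (X 1 \<omega>))\<bar> \<ge> r * n}
        \<le> 2 * exp (- 2 * (r * n)\<^sup>2 / (s * (A - - A)\<^sup>2))"
  proof -
    have "0 \<le> r * n" "- A < A" "{1..s} \<noteq> {}" "card {1..s} = s"
      using assms(3-6) by auto
    then show ?thesis
      using H.Hoeffding_ineq_abs_ge[of "r * n"] by metis
  qed
  also have "\<dots> \<le> 2 * exp (- (r\<^sup>2 / (2 * A\<^sup>2)) * n)"
  proof -
    \<comment> \<open>The Hoeffding exponent carries an additional factor n / s, which is at least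
      1.\<close>
    have "r\<^sup>2 / (2 * A\<^sup>2) * n \<le> r\<^sup>2 / (2 * A\<^sup>2) * n * (n / s)"
    proof -
      have "0 \<le> r\<^sup>2 / (2 * A\<^sup>2) * n" "1 \<le> real n / s"
        using assms(3-6) by simp_all
      then show ?thesis
        by (metis mult_left_mono mult.right_neutral)
    qed
    also have "\<dots> = 2 * (r * n)\<^sup>2 / (s * (A - - A)\<^sup>2)"
      using assms(3-6) by (simp add: field_simps power2_eq_square)
    finally show ?thesis
      by simp
  qed
  finally show ?thesis .
qed

text \<open>The level A depends on the law, \<epsilon> and \<eta>, but not on n. It can thus be
  fixed before the thresholds tend to infinity.\<close>

lemma partial_sums_deviation_prob:
  fixes X :: "nat \<Rightarrow> 'a \<Rightarrow> real" and \<mu> \<epsilon> \<eta> :: real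
  assumes indep: "indep_vars (\<lambda>_. borel) X {1..}"
    and ident: "\<And>j. j \<ge> 1 \<Longrightarrow> distr M borel (X j) = distr M borel (X 1)"
    and int: "integrable M (X 1)" and mean: "expectation (X 1) = \<mu>"
    and "\<epsilon> > 0" "\<eta> > 0"
  obtains A where "A > 0"
    "\<forall>\<^sub>F n in sequentially. prob {\<omega>\<in>space M.
       (\<exists>s\<le>n. \<bar>psum (\<lambda>j. X j \<omega>) s - \<mu> * s\<bar> > \<epsilon> * n) \<or> (\<Sum>j = 1..n. excess A (X j \<omega>)) > \<epsilon> * n} \<le> \<eta>"
proof -
  have rv: "X j \<in> borel_measurable M" if "j \<ge> 1" for j
    using indep that by (auto simp: indep_vars_def)
  have [measurable]: "X 1 \<in> borel_measurable M"
    by (rule rv) simp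
  \<comment> \<open>The deviation of a partial sum has three sources: fluctuation of the truncated
    sum, excess of the large steps, and bias of the truncated mean. Each is allowed r n.\<close>
  define r where "r = \<epsilon> / 3"
  have "r > 0"
    using \<open>\<epsilon> > 0\<close> by (simp add: r_def)
  \<comment> \<open>The bound r controls the bias of the truncated mean; the bound r \<eta> / 2
    makes the Markov estimate for the total excess at most \<eta> / 2.\<close>
  have "\<forall>\<^sub>F A in at_top. expectation (\<lambda>\<omega>. excess A (X 1 \<omega>)) < min r (r * \<eta> / 2)"
    using excess_expectation_tendsto_0[OF int] \<open>r > 0\<close> \<open>\<eta> > 0\<close> by (intro order_tendstoD(2)) auto
  then have "\<forall>\<^sub>F A in at_top. expectation (\<lambda>\<omega>. excess A (X 1 \<omega>)) < min r (r * \<eta> / 2) \<and> A > 0"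
    using eventually_gt_at_top[of 0] by eventually_elim auto
  then obtain A where e: "expectation (\<lambda>\<omega>. excess A (X 1 \<omega>)) < min r (r * \<eta> / 2)" and "A > 0"
    by (auto dest!: eventually_happens)
  define e where "e = expectation (\<lambda>\<omega>. excess A (X 1 \<omega>))"
  define \<nu> where "\<nu> = expectation (\<lambda>\<omega>. trunc A (X 1 \<omega>))"
  define c where "c = r\<^sup>2 / (2 * A\<^sup>2)"
  have "c > 0"
    using \<open>r > 0\<close> \<open>A > 0\<close> by (simp add: c_def)
  have int_trunc: "integrable M (\<lambda>\<omega>. trunc A (X 1 \<omega>))"
    by (rule Bochner_Integration.integrable_bound[OF int _ AE_I2])
      (measurable, simp add: trunc_def)
  have int_excess1: "integrable M (\<lambda>\<omega>. excess A (X 1 \<omega>))"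
    unfolding excess_def using int int_trunc by auto
  have int_excess: "integrable M (\<lambda>\<omega>. excess A (X j \<omega>))"
    and exp_excess: "expectation (\<lambda>\<omega>. excess A (X j \<omega>)) = e" if "j \<ge> 1" for j
    unfolding e_def using int_excess1
    by (intro integrable_of_distr_eq[OF ident[OF that] rv[OF that]]
        expectation_eq_of_distr_eq[OF ident[OF that] rv[OF that]]; measurable)+
  have mean_diff: "\<bar>\<nu> - \<mu>\<bar> \<le> e"
  proof -
    have "\<mu> - \<nu> = expectation (\<lambda>\<omega>. X 1 \<omega> - trunc A (X 1 \<omega>))"
      using int int_trunc mean by (simp add: \<nu>_def)
    also have "\<bar>\<dots>\<bar> \<le> e"
      unfolding e_def excess_def by (rule integral_abs_bound)
    finally show ?thesis
      by (simp add: abs_minus_commute)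
  qed

  define H where "H n s = {\<omega>\<in>space M. \<bar>(\<Sum>j = 1..s. trunc A (X j \<omega>)) - s * \<nu>\<bar> \<ge> r * n}" for n s :: nat
  define E where "E n = {\<omega>\<in>space M. (\<Sum>j = 1..n. excess A (X j \<omega>)) \<ge> r * n}" for n :: nat
  have meas_trunc: "(\<lambda>\<omega>. \<Sum>j = 1..s. trunc A (X j \<omega>)) \<in> borel_measurable M" for s
    using rv by (intro borel_measurable_sum measurable_compose[OF _ measurable_trunc]) auto
  have meas_excess: "(\<lambda>\<omega>. \<Sum>j = 1..s. excess A (X j \<omega>)) \<in> borel_measurable M" for s
    using rv by (intro borel_measurable_sum measurable_compose[OF _ measurable_excess]) auto
  note [measurable] = meas_trunc meas_excess
  have H_sets [measurable]: "H n s \<in> events" and E_sets [measurable]: "E n \<in> events" for n s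
    unfolding H_def E_def by measurable
  have bad_subset: "{\<omega>\<in>space M. (\<exists>s\<le>n. \<bar>psum (\<lambda>j. X j \<omega>) s - \<mu> * s\<bar> > \<epsilon> * n) \<or>
      (\<Sum>j = 1..n. excess A (X j \<omega>)) > \<epsilon> * n} \<subseteq> (\<Union>s\<in>{1..n}. H n s) \<union> E n" for n
  proof
    fix \<omega>
    assume bad: "\<omega> \<in> {\<omega>\<in>space M. (\<exists>s\<le>n. \<bar>psum (\<lambda>j. X j \<omega>) s - \<mu> * s\<bar> > \<epsilon> * n) \<or>
      (\<Sum>j = 1..n. excess A (X j \<omega>)) > \<epsilon> * n}"
    show "\<omega> \<in> (\<Union>s\<in>{1..n}. H n s) \<union> E n"
    proof (rule ccontr)
      assume "\<not> ?thesis"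
      then have notH: "\<And>s. 1 \<le> s \<Longrightarrow> s \<le> n \<Longrightarrow> \<bar>(\<Sum>j = 1..s. trunc A (X j \<omega>)) - s * \<nu>\<bar> < r * n"
        and notE: "(\<Sum>j = 1..n. excess A (X j \<omega>)) < r * n"
        using bad by (auto simp: H_def E_def not_le)
      have "\<epsilon> * n = r * n + r * n + r * n" "r * n \<ge> 0"
        using \<open>r > 0\<close> by (auto simp: r_def)
      with notE bad obtain s where s: "s \<le> n" "\<bar>psum (\<lambda>j. X j \<omega>) s - \<mu> * s\<bar> > \<epsilon> * n"
        by auto
      \<comment> \<open>At s = 0 both the sum and its drift vanish, so a union over s from 1 to n
        suffices.\<close>
      have "s \<ge> 1"
        using s \<open>\<epsilon> > 0\<close> by (cases s) (auto simp: not_less mult_less_0_iff)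
      have "s * \<bar>\<nu> - \<mu>\<bar> \<le> n * r"
        using s(1) mean_diff e by (intro mult_mono) (auto simp: e_def)
      then have "\<bar>s * \<nu> - \<mu> * s\<bar> \<le> r * n"
        by (metis abs_mult abs_of_nat mult.commute right_diff_distrib)
      with abs_psum_diff_trunc_le[OF s(1), of "\<lambda>j. X j \<omega>" A] notE notH[OF \<open>s \<ge> 1\<close> s(1)] s(2)
        \<open>\<epsilon> * n = r * n + r * n + r * n\<close>
      show False
        by linarith
    qed
  qed
  \<comment> \<open>The union bound costs a factor n, which the exponential decay absorbs; this is
    why Hoeffding's inequality is applied rather than Chebyshev's.\<close>
  have prob_H: "prob (\<Union>s\<in>{1..n}. H n s) \<le> 2 * n * exp (- c * n)" for n
  proof -
    have "prob (\<Union>s\<in>{1..n}. H n s) \<le> (\<Sum>s\<in>{1..n}. prob (H n s))"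
      by (intro finite_measure_subadditive_finite) auto
    also have "\<dots> \<le> (\<Sum>s\<in>{1..n}. 2 * exp (- c * n))"
      unfolding H_def \<nu>_def c_def using \<open>A > 0\<close> \<open>r > 0\<close>
      by (intro sum_mono trunc_sum_deviation_prob_le[OF indep ident]) auto
    finally show ?thesis
      by simp
  qed
  have prob_E: "prob (E n) \<le> \<eta> / 2" if "n > 0" for n
  proof -
    have "prob (E n) \<le> expectation (\<lambda>\<omega>. \<Sum>j = 1..n. excess A (X j \<omega>)) / (r * n)"
      unfolding E_def using that \<open>r > 0\<close>
      by (intro integral_Markov_inequality_measure[where A = "{}"])
        (auto intro!: sum_nonneg Bochner_Integration.integrable_sum int_excess)
    also have "expectation (\<lambda>\<omega>. \<Sum>j = 1..n. excess A (X j \<omega>)) = n * e"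
      using int_excess exp_excess by (subst Bochner_Integration.integral_sum) auto
    also have "n * e / (r * n) = e / r"
      using that by simp
    also have "\<dots> \<le> \<eta> / 2"
      using e \<open>r > 0\<close> by (simp add: e_def divide_le_eq mult.commute)
    finally show ?thesis .
  qed
  have "(\<lambda>n. 2 * real n * exp (- c * real n)) \<longlonglongrightarrow> 0"
    using \<open>c > 0\<close> by real_asymp
  then have "\<forall>\<^sub>F n in sequentially. 2 * real n * exp (- c * real n) < \<eta> / 2"
    using \<open>\<eta> > 0\<close> by (intro order_tendstoD(2)) auto
  then have "\<forall>\<^sub>F n in sequentially. prob {\<omega>\<in>space M.
       (\<exists>s\<le>n. \<bar>psum (\<lambda>j. X j \<omega>) s - \<mu> * s\<bar> > \<epsilon> * n) \<or> (\<Sum>j = 1..n. excess A (X j \<omega>)) > \<epsilon> * n} \<le> \<eta>"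
    using eventually_gt_at_top[of 0]
  proof eventually_elim
    case (elim n)
    have "prob {\<omega>\<in>space M.
       (\<exists>s\<le>n. \<bar>psum (\<lambda>j. X j \<omega>) s - \<mu> * s\<bar> > \<epsilon> * n) \<or> (\<Sum>j = 1..n. excess A (X j \<omega>)) > \<epsilon> * n}
      \<le> prob ((\<Union>s\<in>{1..n}. H n s) \<union> E n)"
      by (intro finite_measure_mono bad_subset) measurable
    also have "\<dots> \<le> prob (\<Union>s\<in>{1..n}. H n s) + prob (E n)"
      by (intro measure_Un_le) auto
    also have "\<dots> \<le> \<eta>"
      using prob_H[of n] prob_E[of n] elim by linarith
    finally show ?case .
  qed
  with \<open>A > 0\<close> show ?thesis
    by (rule that)
qed

text \<open>Outside the deviation event of \<open>partial_sums_deviation_prob\<close>, the pathwise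
  bound \<open>passage_rate_bound\<close> applies for all late indices. The case where the last
  passage time is 0 is counted as bad, so a zero denominator is covered too.\<close>

lemma passage_rate_in_prob:
  fixes X :: "nat \<Rightarrow> 'a \<Rightarrow> real" and D :: "'i \<Rightarrow> real" and t :: "'i \<Rightarrow> nat" and \<mu> \<epsilon> :: real
  assumes indep: "indep_vars (\<lambda>_. borel) X {1..}"
    and ident: "\<And>j. j \<ge> 1 \<Longrightarrow> distr M borel (X j) = distr M borel (X 1)"
    and int: "integrable M (X 1)" and mean: "expectation (X 1) = \<mu>" and "\<mu> > 0"
    and D_pos: "\<And>i. D i > 0" and D_lim: "filterlim D at_top F" and t_lim: "filterlim t at_top F"
    and D_o: "D \<in> o[F](\<lambda>i. real (t i))" and "\<epsilon> > 0"
  shows "((\<lambda>i. prob {\<omega>\<in>space M. last_passage (psum (\<lambda>j. X j \<omega>)) (D i) (t i) = 0 \<or>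
           \<bar>D i * num_passages (psum (\<lambda>j. X j \<omega>)) (D i) (t i) /
              last_passage (psum (\<lambda>j. X j \<omega>)) (D i) (t i) - \<mu>\<bar> > \<epsilon>}) \<longlongrightarrow> 0) F"
    (is "((\<lambda>i. prob (?B i)) \<longlongrightarrow> 0) F")
proof (rule order_tendstoI)
  fix a :: real
  assume "a < 0"
  then show "\<forall>\<^sub>F i in F. a < prob (?B i)"
    by (intro always_eventually allI) (auto intro: less_le_trans)
next
  fix \<eta> :: real
  assume "0 < \<eta>"
  have rv: "X j \<in> borel_measurable M" if "j \<ge> 1" for j
    using indep that by (auto simp: indep_vars_def)
  \<comment> \<open>The factor 6 is the one in \<open>passage_rate_bound\<close>, both in its
    conclusion and in its smallness condition relative to \<mu>.\<close>
  define \<delta> where "\<delta> = min (\<epsilon> / 6) (\<mu> / 6)"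
  have "\<delta> > 0" "6 * \<delta> \<le> \<epsilon>" "6 * \<delta> \<le> \<mu>"
    using \<open>\<epsilon> > 0\<close> \<open>\<mu> > 0\<close> by (auto simp: \<delta>_def)
  obtain A where "A > 0" and dev:
    "\<forall>\<^sub>F n in sequentially. prob {\<omega>\<in>space M. (\<exists>s\<le>n. \<bar>psum (\<lambda>j. X j \<omega>) s - \<mu> * s\<bar> > \<delta> * n) \<or>
       (\<Sum>j = 1..n. excess A (X j \<omega>)) > \<delta> * n} \<le> \<eta> / 2"
    using partial_sums_deviation_prob[OF indep ident int mean \<open>\<delta> > 0\<close>, of "\<eta> / 2"] \<open>\<eta> > 0\<close>
    by auto
  have "\<forall>\<^sub>F i in F. prob {\<omega>\<in>space M. (\<exists>s\<le>t i. \<bar>psum (\<lambda>j. X j \<omega>) s - \<mu> * s\<bar> > \<delta> * t i) \<or>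
       (\<Sum>j = 1..t i. excess A (X j \<omega>)) > \<delta> * t i} \<le> \<eta> / 2"
    using eventually_compose_filterlim[OF dev t_lim] .
  \<comment> \<open>Since \<open>A\<close> is fixed, divergence of \<open>D\<close> yields
    hypothesis \<open>A_D\<close> of the pathwise bound; hypothesis \<open>D_t\<close> comes from
    the little-o condition below.\<close>
  moreover have "\<forall>\<^sub>F i in F. D i \<ge> A * (2 * \<mu>) / \<delta>"
    using D_lim by (simp add: filterlim_at_top)
  moreover have "\<forall>\<^sub>F i in F. norm (D i) \<le> \<delta> * norm (real (t i))"
    using landau_o.smallD[OF D_o \<open>\<delta> > 0\<close>] .
  moreover have "\<forall>\<^sub>F i in F. t i \<ge> 1"
    using t_lim by (simp add: filterlim_at_top)
  ultimately show "\<forall>\<^sub>F i in F. prob (?B i) < \<eta>"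
  proof eventually_elim
    case (elim i)
    have [measurable]: "(\<lambda>\<omega>. psum (\<lambda>j. X j \<omega>) u) \<in> borel_measurable M" for u
      using rv by (rule measurable_psum)
    have [measurable]: "(\<lambda>\<omega>. \<Sum>j = 1..u. excess A (X j \<omega>)) \<in> borel_measurable M" for u
      using rv by (intro borel_measurable_sum measurable_compose[OF _ measurable_excess]) auto
    have "prob (?B i) \<le> prob {\<omega>\<in>space M. (\<exists>s\<le>t i. \<bar>psum (\<lambda>j. X j \<omega>) s - \<mu> * s\<bar> > \<delta> * t i) \<or>
       (\<Sum>j = 1..t i. excess A (X j \<omega>)) > \<delta> * t i}"
    proof (intro finite_measure_mono subsetI)
      fix \<omega>
      assume \<omega>: "\<omega> \<in> ?B i"
      show "\<omega> \<in> {\<omega>\<in>space M. (\<exists>s\<le>t i. \<bar>psum (\<lambda>j. X j \<omega>) s - \<mu> * s\<bar> > \<delta> * t i) \<or>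
       (\<Sum>j = 1..t i. excess A (X j \<omega>)) > \<delta> * t i}"
      proof (rule ccontr)
        assume "\<not> ?thesis"
        then have good: "\<And>s. s \<le> t i \<Longrightarrow> \<bar>psum (\<lambda>j. X j \<omega>) s - \<mu> * s\<bar> \<le> \<delta> * t i"
          "(\<Sum>j = 1..t i. excess A (X j \<omega>)) \<le> \<delta> * t i"
          using \<omega> by (auto simp: not_less)
        have "D i \<le> \<delta> * t i" "A * (2 * \<mu>) \<le> \<delta> * D i" "t i > 0"
          using elim \<open>\<delta> > 0\<close> D_pos[of i] by (auto simp: field_simps)
        note passage_rate_bound[OF D_pos[of i] \<open>A > 0\<close> \<open>t i > 0\<close> \<open>\<mu> > 0\<close> \<open>\<delta> > 0\<close> \<open>6 * \<delta> \<le> \<mu>\<close>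
            this(1,2) good]
        then show False
          using \<omega> \<open>6 * \<delta> \<le> \<epsilon>\<close> by auto
      qed
    qed measurable
    also have "\<dots> < \<eta>"
      using elim \<open>\<eta> > 0\<close> by simp
    finally show ?case .
  qed
qed

end

section \<open>From the components to the estimator\<close>

lemma filterlim_Min_at_top_component:
  fixes f :: "'i \<Rightarrow> 'k \<Rightarrow> real"
  assumes "filterlim (\<lambda>i. Min (f i ` I)) at_top F" "finite I" "k \<in> I"
  shows "filterlim (\<lambda>i. f i k) at_top F"
  using assms by (auto intro!: filterlim_at_top_mono[OF assms(1)] always_eventually Min_le)

lemma smallo_Max_component:
  fixes f :: "'i \<Rightarrow> 'k \<Rightarrow> real"
  assumes "(\<lambda>i. Max (f i ` I)) \<in> o[F](g)" "finite I" "k \<in> I" "\<And>i. f i k \<ge> 0"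
  shows "(\<lambda>i. f i k) \<in> o[F](g)"
proof (rule landau_o.big_small_trans[OF _ assms(1)], rule landau_o.bigI[of 1])
  have "f i k \<le> Max (f i ` I)" for i
    using assms by (intro Max_ge) auto
  then show "\<forall>\<^sub>F i in F. norm (f i k) \<le> 1 * norm (Max (f i ` I))"
    using assms(4) by (intro always_eventually allI) (smt (verit) real_norm_def)
qed simp

text \<open>The weights sum to 1, so the error of the average is at most the largest error of a
  component.\<close>

lemma abs_average_diff_le:
  fixes f :: "nat \<Rightarrow> real"
  assumes "K \<ge> 1" "\<And>k. k \<in> {1..K} \<Longrightarrow> \<bar>f k - m\<bar> \<le> \<delta>"
  shows "\<bar>(\<Sum>k = 1..K. 1 / real K * f k) - m\<bar> \<le> \<delta>"
proof -
  have "(\<Sum>k = 1..K. 1 / real K * f k) - m = (\<Sum>k = 1..K. 1 / real K * (f k - m))"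
    using \<open>K \<ge> 1\<close> by (simp add: sum_subtractf sum_distrib_left[symmetric] sum_divide_distrib[symmetric] field_simps)
  also have "\<bar>\<dots>\<bar> \<le> (\<Sum>k = 1..K. \<bar>1 / real K * (f k - m)\<bar>)"
    by (rule sum_abs)
  also have "\<dots> \<le> (\<Sum>k = 1..K. 1 / real K * \<delta>)"
    using assms by (intro sum_mono) (auto simp: abs_mult intro!: divide_right_mono)
  also have "\<dots> = \<delta>"
    using \<open>K \<ge> 1\<close> by simp
  finally show ?thesis .
qed

text \<open>Quantitative continuity of the map from the two moment estimates to the standard
  deviation. The first condition on \<delta> gives the accuracy \<epsilon>; the second keeps the
  radicand nonnegative, so the default value \<open>c\<close> is not taken.\<close>

lemma sigma_hat_close:
  assumes "K \<ge> 1" "\<sigma> > 0" "\<mu> > 0" "0 < \<delta>" "\<delta> \<le> 1"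
    and \<delta>: "\<delta> * (2 + 2 * \<mu>) \<le> \<epsilon> * \<sigma>" "\<delta> * (2 + 2 * \<mu>) \<le> \<sigma>\<^sup>2"
    and tau: "\<And>k. k \<in> {1..K} \<Longrightarrow> tau_last x D t k \<noteq> 0"
      "\<And>k. k \<in> {1..K} \<Longrightarrow>
         \<bar>D k * num_passages (psum (x k)) (D k) t / tau_last x D t k - \<mu>\<bar> \<le> \<delta>"
    and theta: "\<And>k. k \<in> {1..K} \<Longrightarrow> theta_last x G t k \<noteq> 0"
      "\<And>k. k \<in> {1..K} \<Longrightarrow>
         \<bar>G k * num_passages (psum (\<lambda>j. (x k j)\<^sup>2)) (G k) t / theta_last x G t k
           - (\<sigma>\<^sup>2 + \<mu>\<^sup>2)\<bar> \<le> \<delta>"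
  shows "\<bar>sigma_hat c K x D G t - \<sigma>\<bar> \<le> \<epsilon>"
proof -
  define m where "m = mu_hat K x D t"
  define v where "v = var_hat K x D G t"
  have m: "\<bar>m - \<mu>\<bar> \<le> \<delta>"
    unfolding m_def mu_hat_def using assms(1) tau(2) by (rule abs_average_diff_le)
  have "\<bar>(v + m\<^sup>2) - (\<sigma>\<^sup>2 + \<mu>\<^sup>2)\<bar> \<le> \<delta>"
    unfolding v_def m_def var_hat_def diff_add_cancel
    using assms(1) theta(2) by (rule abs_average_diff_le)
  moreover have "\<bar>m\<^sup>2 - \<mu>\<^sup>2\<bar> \<le> \<delta> * (1 + 2 * \<mu>)"
  proof -
    have "\<bar>m\<^sup>2 - \<mu>\<^sup>2\<bar> = \<bar>m - \<mu>\<bar> * \<bar>m + \<mu>\<bar>"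
      by (simp add: abs_mult[symmetric] power2_eq_square algebra_simps)
    \<comment> \<open>Here \<delta> \<le> 1 enters, through \<bar>m + \<mu>\<bar> \<le> 2 \<mu> +
      \<delta> \<le> 2 \<mu> + 1.\<close>
    also have "\<dots> \<le> \<delta> * (1 + 2 * \<mu>)"
      using m assms by (intro mult_mono) auto
    finally show ?thesis .
  qed
  ultimately have v: "\<bar>v - \<sigma>\<^sup>2\<bar> \<le> \<delta> * (2 + 2 * \<mu>)"
    by (simp add: algebra_simps)
  with \<delta>(2) have "v \<ge> 0"
    by linarith
  \<comment> \<open>Multiplication by the conjugate \<open>sqrt v + \<sigma>\<close>, which is at
    least \<sigma>, turns the error of the root into the error of \<open>v\<close>.\<close>
  have "\<bar>sqrt v - \<sigma>\<bar> * \<sigma> \<le> \<bar>sqrt v - \<sigma>\<bar> * (sqrt v + \<sigma>)"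
    using \<open>v \<ge> 0\<close> by (intro mult_left_mono) auto
  also have "\<dots> = \<bar>(sqrt v - \<sigma>) * (sqrt v + \<sigma>)\<bar>"
    using \<open>v \<ge> 0\<close> \<open>\<sigma> > 0\<close> by (simp add: abs_mult)
  also have "(sqrt v - \<sigma>) * (sqrt v + \<sigma>) = v - \<sigma>\<^sup>2"
    using \<open>v \<ge> 0\<close> by (simp add: algebra_simps power2_eq_square)
  also have "\<bar>v - \<sigma>\<^sup>2\<bar> \<le> \<epsilon> * \<sigma>"
    using v \<delta>(1) by linarith
  finally have "\<bar>sqrt v - \<sigma>\<bar> \<le> \<epsilon>"
    using \<open>\<sigma> > 0\<close> by simp
  moreover have "sigma_hat c K x D G t = sqrt v"
    using tau(1) theta(1) \<open>v \<ge> 0\<close> unfolding sigma_hat_def v_def by (meson leD)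
  ultimately show ?thesis
    by simp
qed

lemma measurable_sigma_hat:
  assumes X: "\<And>k j. k \<in> {1..K} \<Longrightarrow> j \<ge> 1 \<Longrightarrow> X k j \<in> borel_measurable M"
  shows "(\<lambda>\<omega>. sigma_hat c K (\<lambda>k j. X k j \<omega>) D G t) \<in> borel_measurable M"
proof -
  have S: "(\<lambda>\<omega>. psum (\<lambda>j. X k j \<omega>) u) \<in> borel_measurable M"
    and Z: "(\<lambda>\<omega>. psum (\<lambda>j. (X k j \<omega>)\<^sup>2) u) \<in> borel_measurable M" if "k \<in> {1..K}" for k u
    by (rule measurable_psum, use X[OF that] in auto)+
  have tau: "(\<lambda>\<omega>. tau_last (\<lambda>k j. X k j \<omega>) D t k) \<in> measurable M (count_space UNIV)"
    and theta: "(\<lambda>\<omega>. theta_last (\<lambda>k j. X k j \<omega>) G t k) \<in> measurable M (count_space UNIV)"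
    and N: "(\<lambda>\<omega>. num_passages (psum (\<lambda>j. X k j \<omega>)) (D k) t) \<in> measurable M (count_space UNIV)"
    and M: "(\<lambda>\<omega>. num_passages (psum (\<lambda>j. (X k j \<omega>)\<^sup>2)) (G k) t) \<in> measurable M (count_space UNIV)"
    if "k \<in> {1..K}" for k
    unfolding tau_last_def theta_last_def using S Z that
    by (auto intro!: measurable_last_passage measurable_num_passages)
  have rate: "(\<lambda>\<omega>. 1 / real K * (r * real (f \<omega>) / real (g \<omega>))) \<in> borel_measurable M"
    if [measurable]: "f \<in> measurable M (count_space UNIV)" "g \<in> measurable M (count_space UNIV)"
    for f g :: "'a \<Rightarrow> nat" and r
    by measurable
  have [measurable]: "(\<lambda>\<omega>. mu_hat K (\<lambda>k j. X k j \<omega>) D t) \<in> borel_measurable M"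
    unfolding mu_hat_def by (intro borel_measurable_sum rate tau N)
  have [measurable]: "(\<lambda>\<omega>. var_hat K (\<lambda>k j. X k j \<omega>) D G t) \<in> borel_measurable M"
    unfolding var_hat_def by (intro borel_measurable_diff borel_measurable_sum rate theta M) measurable
  have [measurable]: "Measurable.pred M (\<lambda>\<omega>. \<exists>k\<in>{1..K}. tau_last (\<lambda>k j. X k j \<omega>) D t k = 0 \<or>
      theta_last (\<lambda>k j. X k j \<omega>) G t k = 0)"
    using tau theta by (intro pred_intros_finite) (auto intro!: pred_intros_logic)
  show ?thesis
    unfolding sigma_hat_def by measurable
qed

section \<open>Convergence in probability of \<open>sigma_hat\<close>\<close>

theorem theorem4p2:
  fixes M :: "'a measure"
    and X :: "nat \<Rightarrow> nat \<Rightarrow> 'a \<Rightarrow> real"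
    and sd :: "nat \<Rightarrow> real"
    and \<mu> \<sigma> c :: real
    and K :: nat
    and F :: "'i filter"
    and \<Delta> \<Gamma> :: "'i \<Rightarrow> nat \<Rightarrow> real"
    and t :: "'i \<Rightarrow> nat"
  assumes "prob_space M"
    and "K \<ge> 1"
    and indep_within: "\<And>k. k \<in> {1..K} \<Longrightarrow> prob_space.indep_vars M (\<lambda>_. borel) (X k) {1..}"
    and identical: "\<And>k j. k \<in> {1..K} \<Longrightarrow> j \<ge> 1 \<Longrightarrow> distr M borel (X k j) = distr M borel (X k 1)"
    and indep_between: "prob_space.indep_vars M (\<lambda>_. PiM {1..} (\<lambda>_. borel))
           (\<lambda>k \<omega>. \<lambda>j\<in>{1..}. X k j \<omega>) {1..K}"
    and third_moment: "\<And>k. k \<in> {1..K} \<Longrightarrow> integrable M (\<lambda>\<omega>. \<bar>X k 1 \<omega>\<bar> ^ 3)"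
    and mean: "\<And>k. k \<in> {1..K} \<Longrightarrow> prob_space.expectation M (X k 1) = \<mu>"
    and "\<mu> > 0"
    and sd: "\<And>k. k \<in> {1..K} \<Longrightarrow> sd k = sqrt (prob_space.variance M (X k 1))"
    and common_sd: "\<And>k. k \<in> {1..K} \<Longrightarrow> (sd k)\<^sup>2 = \<sigma>\<^sup>2"
    and "\<sigma> > 0"
    and thresholds_pos: "\<And>i k. k \<in> {1..K} \<Longrightarrow> \<Delta> i k > 0 \<and> \<Gamma> i k > 0"
    and "filterlim (\<lambda>i. Min (\<Gamma> i ` {1..K})) at_top F"
    and "filterlim (\<lambda>i. Min (\<Delta> i ` {1..K})) at_top F"
    and "filterlim t at_top F"
    and "(\<lambda>i. Max (\<Gamma> i ` {1..K})) \<in> o[F](\<lambda>i. real (t i))"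
    and "(\<lambda>i. Max (\<Delta> i ` {1..K})) \<in> o[F](\<lambda>i. real (t i))"
  shows "tendsto_in_prob M F (\<lambda>i \<omega>. sigma_hat c K (\<lambda>k j. X k j \<omega>) (\<Delta> i) (\<Gamma> i) (t i)) \<sigma>"
proof -
  interpret prob_space M
    by fact
  have rv: "X k j \<in> borel_measurable M" if "k \<in> {1..K}" "j \<ge> 1" for k j
    using indep_within[OF that(1)] that(2) by (auto simp: indep_vars_def)
  have int2: "integrable M (\<lambda>\<omega>. (X k 1 \<omega>)\<^sup>2)" if k: "k \<in> {1..K}" for k
  proof (rule Bochner_Integration.integrable_bound)
    show "integrable M (\<lambda>\<omega>. 1 + \<bar>X k 1 \<omega>\<bar> ^ 3)"
      using third_moment[OF k] by simp
    show "(\<lambda>\<omega>. (X k 1 \<omega>)\<^sup>2) \<in> borel_measurable M"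
      using rv[OF k, of 1] by simp
    \<comment> \<open>This pointwise comparison yields the finite second moment from the third;
      integrability of \<open>X k 1\<close> itself then follows from that of its square.\<close>
    have "y\<^sup>2 \<le> 1 + \<bar>y\<bar> ^ 3" for y :: real
    proof (cases "\<bar>y\<bar> \<le> 1")
      case True
      then have "\<bar>y\<bar>\<^sup>2 \<le> 1"
        by (intro power_le_one) auto
      then show ?thesis
        by (simp add: add_increasing2)
    next
      case False
      then have "\<bar>y\<bar>\<^sup>2 \<le> \<bar>y\<bar> ^ 3"
        by (intro power_increasing) auto
      then show ?thesis
        by simp
    qed
    then show "AE \<omega> in M. norm ((X k 1 \<omega>)\<^sup>2) \<le> norm (1 + \<bar>X k 1 \<omega>\<bar> ^ 3)"
      by (intro AE_I2) simp
  qed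
  have int1: "integrable M (X k 1)" if k: "k \<in> {1..K}" for k
    by (rule square_integrable_imp_integrable[OF rv[OF k order_refl] int2[OF k]])
  have second_moment: "expectation (\<lambda>\<omega>. (X k 1 \<omega>)\<^sup>2) = \<sigma>\<^sup>2 + \<mu>\<^sup>2" if k: "k \<in> {1..K}" for k
  proof -
    have "variance (X k 1) = (sd k)\<^sup>2"
      unfolding sd[OF k] by (rule real_sqrt_pow2[symmetric]) (rule variance_positive)
    then show ?thesis
      using variance_eq[OF int1[OF k] int2[OF k]] by (simp only: mean[OF k] common_sd[OF k])
  qed

  define bad_tau where "bad_tau k \<delta> i = {\<omega>\<in>space M.
      last_passage (psum (\<lambda>j. X k j \<omega>)) (\<Delta> i k) (t i) = 0 \<or>
      \<bar>\<Delta> i k * num_passages (psum (\<lambda>j. X k j \<omega>)) (\<Delta> i k) (t i) /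
         last_passage (psum (\<lambda>j. X k j \<omega>)) (\<Delta> i k) (t i) - \<mu>\<bar> > \<delta>}" for k \<delta> i
  define bad_theta where "bad_theta k \<delta> i = {\<omega>\<in>space M.
      last_passage (psum (\<lambda>j. (X k j \<omega>)\<^sup>2)) (\<Gamma> i k) (t i) = 0 \<or>
      \<bar>\<Gamma> i k * num_passages (psum (\<lambda>j. (X k j \<omega>)\<^sup>2)) (\<Gamma> i k) (t i) /
         last_passage (psum (\<lambda>j. (X k j \<omega>)\<^sup>2)) (\<Gamma> i k) (t i) - (\<sigma>\<^sup>2 + \<mu>\<^sup>2)\<bar> > \<delta>}" for k \<delta> i
  have bad_tau_lim: "((\<lambda>i. prob (bad_tau k \<delta> i)) \<longlongrightarrow> 0) F" if k: "k \<in> {1..K}" and "\<delta> > 0" for k \<delta>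
    unfolding bad_tau_def
  proof (rule passage_rate_in_prob[OF indep_within[OF k] identical[OF k] int1[OF k] mean[OF k]])
    show "filterlim (\<lambda>i. \<Delta> i k) at_top F"
      by (rule filterlim_Min_at_top_component[OF assms(14) finite_atLeastAtMost k])
    show "(\<lambda>i. \<Delta> i k) \<in> o[F](\<lambda>i. real (t i))"
      by (rule smallo_Max_component[OF assms(17) finite_atLeastAtMost k])
        (use thresholds_pos[OF k] in \<open>simp add: less_imp_le\<close>)
  qed (use that thresholds_pos[OF k] \<open>\<mu> > 0\<close> assms(15) in simp_all)
  \<comment> \<open>The squares are again i.i.d. and integrable, with positive mean
    \<open>\<sigma>\<^sup>2 + \<mu>\<^sup>2\<close>, so the result for one sequence applies to them
    with threshold \<Gamma>.\<close>
  have bad_theta_lim: "((\<lambda>i. prob (bad_theta k \<delta> i)) \<longlongrightarrow> 0) F" if k: "k \<in> {1..K}" and "\<delta> > 0" for k \<delta>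
    unfolding bad_theta_def
  proof (rule passage_rate_in_prob)
    show "indep_vars (\<lambda>_. borel) (\<lambda>j \<omega>. (X k j \<omega>)\<^sup>2) {1..}"
      by (rule indep_vars_compose2[OF indep_within[OF k]]) auto
    show "distr M borel (\<lambda>\<omega>. (X k j \<omega>)\<^sup>2) = distr M borel (\<lambda>\<omega>. (X k 1 \<omega>)\<^sup>2)" if "j \<ge> 1" for j
    proof -
      have sq: "(\<lambda>x::real. x\<^sup>2) \<in> borel_measurable borel"
        by simp
      have "distr (distr M borel (X k j)) borel (\<lambda>x. x\<^sup>2) = distr (distr M borel (X k 1)) borel (\<lambda>x. x\<^sup>2)"
        using identical[OF k that] by simp
      then show ?thesis
        by (simp only: distr_distr[OF sq rv[OF k that]] distr_distr[OF sq rv[OF k order_refl]] comp_def)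
    qed
    show "filterlim (\<lambda>i. \<Gamma> i k) at_top F"
      by (rule filterlim_Min_at_top_component[OF assms(13) finite_atLeastAtMost k])
    show "(\<lambda>i. \<Gamma> i k) \<in> o[F](\<lambda>i. real (t i))"
      by (rule smallo_Max_component[OF assms(16) finite_atLeastAtMost k])
        (use thresholds_pos[OF k] in \<open>simp add: less_imp_le\<close>)
    show "\<sigma>\<^sup>2 + \<mu>\<^sup>2 > 0"
      using \<open>\<mu> > 0\<close> by (simp add: add_nonneg_pos)
  qed (use that thresholds_pos[OF k] assms(15) int2[OF k] second_moment[OF k] in simp_all)

  show ?thesis
    unfolding tendsto_in_prob_def
  proof (intro conjI allI impI)
    show "(\<lambda>\<omega>. sigma_hat c K (\<lambda>k j. X k j \<omega>) (\<Delta> i) (\<Gamma> i) (t i)) \<in> borel_measurable M" for i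
      using rv by (rule measurable_sigma_hat)
  next
    fix \<epsilon> :: real
    assume "\<epsilon> > 0"
    \<comment> \<open>The largest \<delta> meeting all the upper bounds on \<delta> in
      \<open>sigma_hat_close\<close>; it is positive because \<epsilon>, \<sigma> and \<mu>
      are.\<close>
    define \<delta> where "\<delta> = min 1 (min (\<epsilon> * \<sigma>) (\<sigma>\<^sup>2) / (2 + 2 * \<mu>))"
    have "\<delta> > 0" "\<delta> \<le> 1"
      using \<open>\<epsilon> > 0\<close> \<open>\<sigma> > 0\<close> \<open>\<mu> > 0\<close> by (auto simp: \<delta>_def)
    have "\<delta> \<le> min (\<epsilon> * \<sigma>) (\<sigma>\<^sup>2) / (2 + 2 * \<mu>)"
      by (simp add: \<delta>_def)
    then have "\<delta> * (2 + 2 * \<mu>) \<le> min (\<epsilon> * \<sigma>) (\<sigma>\<^sup>2)"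
      using \<open>\<mu> > 0\<close> by (subst (asm) pos_le_divide_eq) auto
    then have \<delta>: "\<delta> * (2 + 2 * \<mu>) \<le> \<epsilon> * \<sigma>" "\<delta> * (2 + 2 * \<mu>) \<le> \<sigma>\<^sup>2"
      by simp_all
    let ?B = "\<lambda>i. {\<omega>\<in>space M. \<bar>sigma_hat c K (\<lambda>k j. X k j \<omega>) (\<Delta> i) (\<Gamma> i) (t i) - \<sigma>\<bar> > \<epsilon>}"
    have sets: "bad_tau k \<delta> i \<in> events" "bad_theta k \<delta> i \<in> events" if k: "k \<in> {1..K}" for k i
    proof -
      have S: "(\<lambda>\<omega>. psum (\<lambda>j. X k j \<omega>) u) \<in> borel_measurable M"
        and Z: "(\<lambda>\<omega>. psum (\<lambda>j. (X k j \<omega>)\<^sup>2) u) \<in> borel_measurable M" for u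
        by (rule measurable_psum, use rv[OF k] in auto)+
      note [measurable] = measurable_last_passage[OF S] measurable_last_passage[OF Z]
        measurable_num_passages[OF S] measurable_num_passages[OF Z]
      show "bad_tau k \<delta> i \<in> events" "bad_theta k \<delta> i \<in> events"
        unfolding bad_tau_def bad_theta_def by measurable
    qed
    \<comment> \<open>Off all 2 K bad events both families of rates are \<delta>-accurate, hence the
      estimator is \<epsilon>-accurate; a union bound finishes, K being fixed along the
      filter.\<close>
    have upper: "prob (?B i) \<le> (\<Sum>k\<in>{1..K}. prob (bad_tau k \<delta> i) + prob (bad_theta k \<delta> i))" for i
    proof -
      have "prob (?B i) \<le> prob (\<Union>k\<in>{1..K}. bad_tau k \<delta> i \<union> bad_theta k \<delta> i)"
      proof (rule finite_measure_mono[OF subsetI])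
        fix \<omega>
        assume \<omega>: "\<omega> \<in> ?B i"
        show "\<omega> \<in> (\<Union>k\<in>{1..K}. bad_tau k \<delta> i \<union> bad_theta k \<delta> i)"
        proof (rule ccontr)
          assume "\<not> ?thesis"
          then have good: "\<omega> \<notin> bad_tau k \<delta> i" "\<omega> \<notin> bad_theta k \<delta> i" if "k \<in> {1..K}" for k
            using that by auto
          have "\<bar>sigma_hat c K (\<lambda>k j. X k j \<omega>) (\<Delta> i) (\<Gamma> i) (t i) - \<sigma>\<bar> \<le> \<epsilon>"
          proof (rule sigma_hat_close[OF \<open>K \<ge> 1\<close> \<open>\<sigma> > 0\<close> \<open>\<mu> > 0\<close> \<open>\<delta> > 0\<close> \<open>\<delta> \<le> 1\<close> \<delta>],
              unfold tau_last_def theta_last_def)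
            fix k
            assume k: "k \<in> {1..K}"
            note good[OF k, unfolded bad_tau_def bad_theta_def]
            with \<omega> show "last_passage (psum (\<lambda>j. X k j \<omega>)) (\<Delta> i k) (t i) \<noteq> 0"
              and "last_passage (psum (\<lambda>j. (X k j \<omega>)\<^sup>2)) (\<Gamma> i k) (t i) \<noteq> 0"
              and "\<bar>\<Delta> i k * num_passages (psum (\<lambda>j. X k j \<omega>)) (\<Delta> i k) (t i) /
                last_passage (psum (\<lambda>j. X k j \<omega>)) (\<Delta> i k) (t i) - \<mu>\<bar> \<le> \<delta>"
              and "\<bar>\<Gamma> i k * num_passages (psum (\<lambda>j. (X k j \<omega>)\<^sup>2)) (\<Gamma> i k) (t i) /
                last_passage (psum (\<lambda>j. (X k j \<omega>)\<^sup>2)) (\<Gamma> i k) (t i) - (\<sigma>\<^sup>2 + \<mu>\<^sup>2)\<bar> \<le> \<delta>"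
              by (simp_all only: mem_Collect_eq de_Morgan_disj de_Morgan_conj not_less simp_thms)
          qed
          with \<omega> show False
            by simp
        qed
      qed (use sets in auto)
      also have "\<dots> \<le> (\<Sum>k\<in>{1..K}. prob (bad_tau k \<delta> i \<union> bad_theta k \<delta> i))"
        using sets by (intro finite_measure_subadditive_finite) auto
      also have "\<dots> \<le> (\<Sum>k\<in>{1..K}. prob (bad_tau k \<delta> i) + prob (bad_theta k \<delta> i))"
        using sets by (intro sum_mono measure_Un_le) auto
      finally show ?thesis .
    qed
    have "((\<lambda>i. \<Sum>k\<in>{1..K}. prob (bad_tau k \<delta> i) + prob (bad_theta k \<delta> i)) \<longlongrightarrow> (\<Sum>k\<in>{1..K}. 0 + 0)) F"
      using \<open>\<delta> > 0\<close> by (intro tendsto_sum tendsto_add bad_tau_lim bad_theta_lim)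
    then have "((\<lambda>i. \<Sum>k\<in>{1..K}. prob (bad_tau k \<delta> i) + prob (bad_theta k \<delta> i)) \<longlongrightarrow> 0) F"
      by simp
    then show "((\<lambda>i. prob (?B i)) \<longlongrightarrow> 0) F"
      by (rule tendsto_sandwich[rotated 3]) (rule always_eventually allI measure_nonneg upper tendsto_const)+
  qed
qed

end
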